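(* Let $x$ be an $\omega$-power-free infinite word. Then for every integer $k>1$ and every position $i\geq 1$ of $x$, there is a factor of $x$ starting at position $i$ which is a $k$-anti-power (equivalently, the suffix $x_ix_{i+1}\cdots$ has a prefix which is a $k$-anti-power).
   Context: A $k$-anti-power is a word $u_1\cdots u_k$ with $u_1,\ldots,u_k$ non-empty words of the same length that are pairwise distinct. An infinite word $x$ is $\omega$-power-free if for every non-empty finite factor $u$ of $x$ there exists a positive integer $l$ such that $u^l$ (concatenation of $l$ copies of $u$) is not a factor of $x$.
   Formalization: The infinite word x is assumed to be over a finite alphabet; over an infinite alphabet the claim fails, e.g. for x = a_1^{n_1} a_2^{n_2}... with distinct letters and rapidly growing exponents, which has no 5-anti-power prefix. *)

theory Defs
  imports "HOL-Library.Omega_Words_Fun"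
begin

definition anti_power :: "nat \<Rightarrow> 'a list \<Rightarrow> bool" where
  "anti_power k w \<longleftrightarrow>
     (\<exists>us m. length us = k \<and> m > 0 \<and> (\<forall>u\<in>set us. length u = m) \<and> distinct us \<and> w = concat us)"

definition word_power :: "'a list \<Rightarrow> nat \<Rightarrow> 'a list" where
  "word_power u l = concat (replicate l u)"

text \<open>Infinite words are written \<open>x\<^sub>1 x\<^sub>2 x\<^sub>3 \<dots>\<close>, so positions count from 1, whereas the
  library type \<^typ>\<open>'a word\<close> is indexed from 0: position \<open>i \<ge> 1\<close> is index \<open>i - 1\<close>.\<close>

definition factor_at :: "'a word \<Rightarrow> nat \<Rightarrow> 'a list \<Rightarrow> bool" where
  "factor_at x i u \<longleftrightarrow> i \<ge> 1 \<and> (\<exists>n. u = prefix n (suffix (i - 1) x))"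

definition is_factor :: "'a list \<Rightarrow> 'a word \<Rightarrow> bool" where
  "is_factor u x \<longleftrightarrow> (\<exists>i. factor_at x i u)"

definition omega_power_free :: "'a word \<Rightarrow> bool" where
  "omega_power_free x \<longleftrightarrow>
     (\<forall>u. u \<noteq> [] \<and> is_factor u x \<longrightarrow> (\<exists>l>0. \<not> is_factor (word_power u l) x))"

end

theory Submission
  imports Defs
begin

text \<open>If no \<open>k\<close>-anti-power starts at a given position, then for every block length \<open>m\<close> two of the
  first \<open>k\<close> blocks coincide. By pigeonhole the same pair \<open>a < b\<close> of blocks serves two nearby
  lengths \<open>m\<close> and \<open>m + d\<close>, and comparing both coincidences on their common range exhibits a factor of
  length at least \<open>m - a * d\<close> with period \<open>(b - a) * d\<close>. This period is at most \<open>k ^ 3\<close>, while \<open>m\<close> is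
  arbitrary, so the word contains arbitrarily high powers of words of bounded length. Over a finite
  alphabet there are only finitely many such words.\<close>

lemma factor_at_Suc_iff:
  "factor_at x (Suc s) u \<longleftrightarrow> (\<forall>j<length u. u ! j = x (s + j))"
proof
  assume "factor_at x (Suc s) u"
  then show "\<forall>j<length u. u ! j = x (s + j)"
    by (auto simp: factor_at_def suffix_def)
next
  assume *: "\<forall>j<length u. u ! j = x (s + j)"
  have "u = prefix (length u) (suffix s x)"
    by (rule nth_equalityI) (use * in \<open>auto simp: suffix_def\<close>)
  then show "factor_at x (Suc s) u"
    by (auto simp: factor_at_def)
qed

lemma is_factor_iff:
  "is_factor u x \<longleftrightarrow> (\<exists>s. \<forall>j<length u. u ! j = x (s + j))"
proof
  assume "is_factor u x"
  then obtain i where i: "factor_at x i u"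
    by (auto simp: is_factor_def)
  then have "i = Suc (i - 1)"
    by (simp add: factor_at_def)
  then show "\<exists>s. \<forall>j<length u. u ! j = x (s + j)"
    using i factor_at_Suc_iff by metis
next
  assume "\<exists>s. \<forall>j<length u. u ! j = x (s + j)"
  then show "is_factor u x"
    unfolding is_factor_def using factor_at_Suc_iff by blast
qed

lemma is_factor_append1:
  assumes "is_factor (u @ v) x"
  shows "is_factor u x"
proof -
  obtain s where s: "\<And>j. j < length (u @ v) \<Longrightarrow> (u @ v) ! j = x (s + j)"
    using assms unfolding is_factor_iff by blast
  have "u ! j = x (s + j)" if "j < length u" for j
    using s[of j] that by (simp add: nth_append)
  then show ?thesis
    unfolding is_factor_iff by blast
qed

lemma is_factor_word_power_mono:
  assumes "is_factor (word_power u n) x" and "l \<le> n"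
  shows "is_factor (word_power u l) x"
proof -
  have "word_power u n = word_power u l @ word_power u (n - l)"
    using \<open>l \<le> n\<close> by (metis word_power_def concat_append replicate_add le_add_diff_inverse)
  then show ?thesis
    using assms(1) is_factor_append1 by metis
qed

lemma length_word_power: "length (word_power u n) = n * length u"
  by (induction n) (auto simp: word_power_def)

lemma word_power_nth:
  assumes "j < n * length u"
  shows "word_power u n ! j = u ! (j mod length u)"
  using assms
proof (induction n arbitrary: j)
  case (Suc n)
  have *: "word_power u (Suc n) = u @ word_power u n"
    by (simp add: word_power_def)
  show ?case
  proof (cases "j < length u")
    case False
    then have "word_power u n ! (j - length u) = u ! ((j - length u) mod length u)"
      using Suc by auto
    then show ?thesis
      using False by (simp add: * nth_append le_mod_geq)
  qed (simp add: * nth_append)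
qed simp

text \<open>Subtracting \<open>P\<close> repeatedly carries each index \<open>j\<close> back to
  \<open>j mod P\<close>, so the window of length \<open>n * P\<close> at \<open>t\<close> only
  repeats its first \<open>P\<close> letters.\<close>

lemma periodic_imp_power:
  fixes x :: "'a word"
  assumes "P > 0" and per: "\<And>j. j < n * P \<Longrightarrow> x (t + j + P) = x (t + j)"
  shows "is_factor (word_power (map (\<lambda>j. x (t + j)) [0..<P]) n) x"
proof -
  have mod: "x (t + j) = x (t + j mod P)" if "j < n * P" for j
    using that
  proof (induction j rule: less_induct)
    case (less j)
    show ?case
    proof (cases "j < P")
      case False
      then have "x (t + j) = x (t + (j - P))"
        using per[of "j - P"] less.prems by simp
      also have "\<dots> = x (t + (j - P) mod P)"
        by (rule less.IH) (use less.prems False \<open>P > 0\<close> in auto)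
      finally show ?thesis
        using False by (simp add: le_mod_geq)
    qed simp
  qed
  show ?thesis
    unfolding is_factor_iff
    by (rule exI[of _ t]) (use mod \<open>P > 0\<close> in \<open>auto simp: length_word_power word_power_nth\<close>)
qed

text \<open>Consecutive blocks of length \<open>m\<close> from index \<open>s\<close> concatenate to
  a factor at that position; were the first \<open>k\<close> of them distinct, it would be a
  \<open>k\<close>-anti-power.\<close>

lemma equal_blocks:
  fixes x :: "'a word"
  assumes no: "\<nexists>w. factor_at x (Suc s) w \<and> anti_power k w" and "m > 0"
  shows "\<exists>a b. a < b \<and> b < k \<and> (\<forall>j<m. x (s + a * m + j) = x (s + b * m + j))"
proof -
  define B where "B = (\<lambda>c. map (\<lambda>j. x (s + c * m + j)) [0..<m])"
  define us where "us = map B [0..<k]"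
  have concat_B: "concat (map B [0..<n]) = map (\<lambda>j. x (s + j)) [0..<n * m]" for n
  proof (induction n)
    case (Suc n)
    have "map (\<lambda>j. x (s + j)) [0..<n * m + m] = map (\<lambda>j. x (s + j)) [0..<n * m] @ B n"
      by (rule nth_equalityI) (auto simp: B_def nth_append)
    then show ?case
      using Suc by (simp add: add.commute)
  qed simp
  have "factor_at x (Suc s) (concat us)"
    unfolding factor_at_Suc_iff us_def concat_B by auto
  then have "\<not> anti_power k (concat us)"
    using no by blast
  moreover have "length us = k" "\<forall>u\<in>set us. length u = m"
    by (auto simp: us_def B_def)
  ultimately have "\<not> distinct us"
    using \<open>m > 0\<close> unfolding anti_power_def by blast
  then obtain a b where "a < b" "b < k" "B a = B b"
    by (auto simp: us_def distinct_conv_nth) (metis linorder_neqE_nat)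
  then show ?thesis
    by (intro exI[of _ a] exI[of _ b]) (auto simp: B_def)
qed

text \<open>Passing from length \<open>m\<close> to \<open>m + d\<close> moves the start of block
  \<open>a\<close> by \<open>a * d\<close> and that of block \<open>b\<close> by
  \<open>b * d\<close>. Going from block \<open>b\<close> to block \<open>a\<close> at length
  \<open>m\<close> and back at length \<open>m + d\<close> therefore results in a net shift by the
  difference \<open>(b - a) * d\<close>. The first move needs its offset \<open>a * d + j\<close> to
  lie inside a block of length \<open>m\<close>.\<close>

lemma two_equal_blocks_imp_periodic:
  fixes x :: "'a word"
  assumes "a \<le> b"
    and m: "\<And>j. j < m \<Longrightarrow> x (s + a * m + j) = x (s + b * m + j)"
    and md: "\<And>j. j < m + d \<Longrightarrow> x (s + a * (m + d) + j) = x (s + b * (m + d) + j)"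
    and "a * d + j < m"
  shows "x (s + b * m + a * d + j + (b - a) * d) = x (s + b * m + a * d + j)"
proof -
  have "(b - a) * d + a * d = b * d"
    using \<open>a \<le> b\<close> by (simp flip: add_mult_distrib)
  then have "s + b * m + a * d + j + (b - a) * d = s + b * (m + d) + j"
    unfolding add_mult_distrib2 by linarith
  then have "x (s + b * m + a * d + j + (b - a) * d) = x (s + b * (m + d) + j)"
    by (rule arg_cong)
  also have "\<dots> = x (s + a * (m + d) + j)"
    using md[of j] \<open>a * d + j < m\<close> by simp
  also have "\<dots> = x (s + b * m + a * d + j)"
    using m[OF \<open>a * d + j < m\<close>] by (simp add: algebra_simps)
  finally show ?thesis .
qed

text \<open>The bounds on \<open>u\<close> do not depend on \<open>n\<close>, so over a finite
  alphabet all exponents draw on one finite set of words.\<close>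

lemma no_anti_power_imp_powers:
  fixes x :: "'a word"
  assumes no: "\<nexists>w. factor_at x (Suc s) w \<and> anti_power k w" and "k > 0"
  shows "\<exists>u. u \<noteq> [] \<and> length u \<le> k ^ 3 \<and> set u \<subseteq> range x \<and> is_factor (word_power u n) x"
proof -
  \<comment> \<open>One \<open>k ^ 3\<close> pays for the initial loss \<open>a * d\<close>, the
    other \<open>n\<close> for the \<open>n\<close> periods \<open>P\<close>.\<close>
  define M where "M = (n + 1) * k ^ 3"
  have "M > 0"
    using \<open>k > 0\<close> by (simp add: M_def)
  then have "\<forall>m\<in>{M..M + k * k}. \<exists>p. fst p < snd p \<and> snd p < k \<and>
      (\<forall>j<m. x (s + fst p * m + j) = x (s + snd p * m + j))"
    using equal_blocks[OF no] by fastforce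
  then obtain f where f: "\<And>m. m \<in> {M..M + k * k} \<Longrightarrow> fst (f m) < snd (f m) \<and> snd (f m) < k \<and>
      (\<forall>j<m. x (s + fst (f m) * m + j) = x (s + snd (f m) * m + j))"
    by metis
  \<comment> \<open>There are \<open>k * k + 1\<close> lengths but at most \<open>k * k\<close>
    pairs; the interval also forces \<open>d \<le> k * k\<close>.\<close>
  have "f ` {M..M + k * k} \<subseteq> {..<k} \<times> {..<k}"
  proof (rule image_subsetI)
    fix m
    assume "m \<in> {M..M + k * k}"
    then show "f m \<in> {..<k} \<times> {..<k}"
      using f[of m] by (simp add: mem_Times_iff)
  qed
  moreover have "card ({..<k} \<times> {..<k}) < card {M..M + k * k}"
    by (simp add: card_cartesian_product)
  ultimately have "\<not> inj_on f {M..M + k * k}"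
    by (metis card_inj_on_le finite_SigmaI finite_lessThan not_le)
  then obtain m m' where mm: "m \<in> {M..M + k * k}" "m' \<in> {M..M + k * k}" "m < m'" "f m = f m'"
    unfolding inj_on_def by (metis linorder_neqE_nat)
  define d where "d = m' - m"
  obtain a b where ab: "f m = (a, b)"
    by fastforce
  have d: "m' = m + d" "0 < d" "d \<le> k * k"
    using mm by (auto simp: d_def)
  have "a < b" "b < k"
    and m: "\<And>j. j < m \<Longrightarrow> x (s + a * m + j) = x (s + b * m + j)"
    and md: "\<And>j. j < m + d \<Longrightarrow> x (s + a * (m + d) + j) = x (s + b * (m + d) + j)"
    using f[OF mm(1)] f[OF mm(2)] ab mm(4) d(1) by auto
  define P where "P = (b - a) * d"
  have "P > 0"
    using \<open>a < b\<close> d by (simp add: P_def)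
  have "b * d \<le> k * (k * k)"
    using d \<open>b < k\<close> by (intro mult_le_mono) auto
  \<comment> \<open>Both summands inherit the bound \<open>k ^ 3\<close> from
    \<open>b * d\<close>.\<close>
  moreover have "P + a * d = b * d"
    using \<open>a < b\<close> by (simp add: P_def flip: add_mult_distrib)
  ultimately have Pk: "P \<le> k ^ 3" "a * d \<le> k ^ 3"
    by (auto simp: power3_eq_cube mult.assoc)
  have "a * d + n * P \<le> m"
  proof -
    have "a * d + n * P \<le> k ^ 3 + n * k ^ 3"
      using Pk by (intro add_mono mult_le_mono) auto
    then show ?thesis
      using mm(1) by (simp add: M_def)
  qed
  define t where "t = s + b * m + a * d"
  have "x (t + j + P) = x (t + j)" if "j < n * P" for j
    unfolding t_def P_def
    using two_equal_blocks_imp_periodic[OF less_imp_le[OF \<open>a < b\<close>] m md, of j]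
      \<open>a * d + n * P \<le> m\<close> that by linarith
  then have "is_factor (word_power (map (\<lambda>j. x (t + j)) [0..<P]) n) x"
    using periodic_imp_power \<open>P > 0\<close> by blast
  then show ?thesis
    using Pk \<open>P > 0\<close> by (intro exI[of _ "map (\<lambda>j. x (t + j)) [0..<P]"]) auto
qed

text \<open>Once a power of \<open>u\<close> fails to be a factor, so do all higher ones; the
  maximum of finitely many exponents thus serves every word of \<open>S\<close>.\<close>

lemma omega_power_free_uniform:
  assumes "omega_power_free x" and "finite S" and "[] \<notin> S"
  shows "\<exists>n. \<forall>u\<in>S. \<not> is_factor (word_power u n) x"
proof -
  have "\<exists>l. \<not> is_factor (word_power u l) x" if "u \<in> S" for u
  proof (cases "is_factor u x")
    case True
    then show ?thesis
      using assms that unfolding omega_power_free_def by metis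
  next
    \<comment> \<open>\<open>omega_power_free\<close> says nothing about non-factors, but for these
      the first power already fails.\<close>
    case False
    then show ?thesis
      by (intro exI[of _ 1]) (simp add: word_power_def)
  qed
  then obtain l where l: "\<And>u. u \<in> S \<Longrightarrow> \<not> is_factor (word_power u (l u)) x"
    by metis
  have "l u \<le> Max (l ` S)" if "u \<in> S" for u
    using that \<open>finite S\<close> by simp
  then show ?thesis
    using l is_factor_word_power_mono by metis
qed

theorem theorem6:
  fixes A :: "'a set" and x :: "'a word"
  assumes "finite A"
    and "range x \<subseteq> A"
    and "omega_power_free x"
  shows "\<forall>k>1. \<forall>i\<ge>1. \<exists>w. factor_at x i w \<and> anti_power k w"
proof (intro allI impI)
  fix k i :: nat
  assume "1 < k" "1 \<le> i"
  then obtain s where i: "i = Suc s"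
    by (cases i) auto
  \<comment> \<open>\<open>S\<close> contains every possible \<open>u\<close> in advance, so
    \<open>n\<close> can be fixed before \<open>u\<close> is known. The empty word is removed
    because all its powers are factors.\<close>
  define S where "S = {u. set u \<subseteq> A \<and> length u \<le> k ^ 3} - {[]}"
  have "finite S"
    using \<open>finite A\<close> by (simp add: S_def finite_lists_length_le)
  moreover have "[] \<notin> S"
    by (simp add: S_def)
  ultimately obtain n where n: "\<forall>u\<in>S. \<not> is_factor (word_power u n) x"
    using omega_power_free_uniform[OF assms(3)] by metis
  show "\<exists>w. factor_at x i w \<and> anti_power k w"
  proof (rule ccontr)
    assume "\<nexists>w. factor_at x i w \<and> anti_power k w"
    then obtain u where "u \<noteq> []" "length u \<le> k ^ 3" "set u \<subseteq> range x"
      and u: "is_factor (word_power u n) x"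
      using no_anti_power_imp_powers[of x s k n] \<open>1 < k\<close> unfolding i by (metis less_trans zero_less_one)
    then have "u \<in> S"
      using assms(2) by (auto simp: S_def)
    then show False
      using n u by blast
  qed
qed

end
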